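(* Let $\mathbf{x}$ be a sample value of $\mathbf{X}$, and assume that: (A2) the joint (resp. marginal) CDF is continuous and has a density function $\rho>0$ on its open support; (A5) the function $f:\mathbb{R}^d\to\mathbb{R}$ is twice (formally) differentiable with respect to each input; (A6) every dependency function $r_{\pi_{i,k}}$ ($k=2,\dots,K$, $i=1,\dots,d_k$) is twice differentiable with respect to $X_{\pi_{i,k}}$. Then, with respect to the tensor metric $G(\mathbf{x})=J^d(\mathbf{x})^{T}J^d(\mathbf{x})$: (i) the gradient of $f$ is $$\mathrm{grad}(f)(\mathbf{x})=G^{-1}(\mathbf{x})\,\nabla f(\mathbf{x});$$ (ii) the Hessian matrix of $f$ is given, for $i,j=1,\dots,d$, by $$\mathrm{Hess}_{ij}(f)(\mathbf{x})=f''_{x_ix_j}(\mathbf{x})-\sum_{k=1}^{d}\Gamma^k_{ij}(\mathbf{x})\,f'_{x_k}(\mathbf{x}).$$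
   Context: $\mathbf{X}=(X_1,\dots,X_d)$ is a random vector of continuous variables with joint CDF $F$, made of independent blocks $\mathbf{X}_{\boldsymbol{\pi}_1},\dots,\mathbf{X}_{\boldsymbol{\pi}_K}$, where $\boldsymbol{\pi}_1,\dots,\boldsymbol{\pi}_K$ is a partition of $\{1,\dots,d\}$, $\mathbf{X}_{\boldsymbol{\pi}_k}=(X_i)_{i\in\boldsymbol{\pi}_k}$ and $d_k=|\boldsymbol{\pi}_k|$. The block $\mathbf{X}_{\boldsymbol{\pi}_1}$ consists of $d_1\ge 0$ independent variables; for $k\ge 2$ the block $\mathbf{X}_{\boldsymbol{\pi}_k}$ consists of $d_k\ge2$ dependent variables. Write $\boldsymbol{\pi}_k=\{\pi_{1,k}<\dots<\pi_{d_k,k}\}$ and $(\sim\pi_{i,k})=(\pi_{1,k},\dots,\pi_{i-1,k},\pi_{i+1,k},\dots,\pi_{d_k,k})$. Coordinates are ordered block by block. For each $k\ge2$ and each $i=1,\dots,d_k$ one uses the dependency model with explanatory variable $X_{\pi_{i,k}}$: $\mathbf{X}_{\sim\pi_{i,k}}=r_{\pi_{i,k}}(X_{\pi_{i,k}},\mathbf{Z}_{\pi_{i,k}})$, where $\mathbf{Z}_{\pi_{i,k}}$ is a vector of $d_k-1$ independent variables, independent of $X_{\pi_{i,k}}$. In this model the component giving $X_{\pi_{\ell,k}}$ ($\ell\ne i$) is written $r_{\pi_{\ell,k}}$. For given $x_{\pi_{i,k}}$ the map $\mathbf{z}\mapsto r_{\pi_{i,k}}(x_{\pi_{i,k}},\mathbf{z})$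 has a unique inverse $r_{\pi_{i,k}}^{-1}(\cdot\mid x_{\pi_{i,k}})$. Define the column vectors (derivatives taken with $\mathbf{Z}_{\pi_{i,k}}$ held fixed) $$J^{(\pi_{i,k})}(\mathbf{x}_{\boldsymbol{\pi}_k})=\left[\frac{\partial r_{\pi_{1,k}}}{\partial x_{\pi_{i,k}}}\cdots\underbrace{1}_{i\text{th}}\cdots\frac{\partial r_{\pi_{d_k,k}}}{\partial x_{\pi_{i,k}}}\right]^{T}\left(x_{\pi_{i,k}},r_{\pi_{i,k}}^{-1}(\mathbf{x}_{\sim\pi_{i,k}}\mid x_{\pi_{i,k}})\right),$$ the matrices $J^d_{\boldsymbol{\pi}_k}(\mathbf{x}_{\boldsymbol{\pi}_k})=[J^{(\pi_{1,k})}(\mathbf{x}_{\boldsymbol{\pi}_k})\ \cdots\ J^{(\pi_{d_k,k})}(\mathbf{x}_{\boldsymbol{\pi}_k})]$, $k\ge2$, and the dependent Jacobian $J^d(\mathbf{x})=\mathrm{blockdiag}(\mathcal{I}_{d_1\times d_1},J^d_{\boldsymbol{\pi}_2}(\mathbf{x}_{\boldsymbol{\pi}_2}),\dots,J^d_{\boldsymbol{\pi}_K}(\mathbf{x}_{\boldsymbol{\pi}_K}))$, of rank $m\le d$. The induced tensor metric is $G(\mathbf{x})=J^d(\mathbf{x})^{T}J^d(\mathbf{x})$. $G^{-1}$ denotes the inverse of $G$ when $m=d$, and the Moore--Penrose generalized inverse of $G$ when $m<d$. The Christoffel symbols are $$\Gamma^k_{ij}=\frac12\sum_{\ell=1}^{d}G^{-1}_{k\ell}(\mathbf{x})\left(G'_{i\ell,x_j}(\mathbf{x})+G'_{j\ell,x_i}(\mathbf{x})-G'_{ij,x_\ell}(\mathbf{x})\right),\quad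 i,j,k=1,\dots,d,$$ where $G'_{i\ell,x_j}$ is the formal partial derivative of the entry $G_{i\ell}$ with respect to $x_j$. Formal derivatives $f'_{x_k}$, $f''_{x_ix_j}$ and $\nabla f=[f'_{x_1},\dots,f'_{x_d}]^T$ are ordinary (Euclidean) partial derivatives with the other inputs held constant. Gradient and Hessian are those of Riemannian geometry for the metric $G$ in the coordinates $\mathbf{x}$: when $G$ is invertible, $\mathrm{grad}(f)(\mathbf{x})$ is the vector with $v^{T}G(\mathbf{x})\,\mathrm{grad}(f)(\mathbf{x})=\nabla f(\mathbf{x})^{T}v$ for all $v\in\mathbb{R}^d$, and $\mathrm{Hess}(f)$ is the second covariant derivative of $f$ for the Levi-Civita connection of $G$; when $m<d$, the same coordinate expressions are used with $G^{-1}$ the generalized inverse. *)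

theory Defs
  imports "HOL-Probability.Probability"
begin

section \<open>Formal derivatives\<close>

text \<open>Points are indexed by an arbitrary finite type. A formal derivative is an ordinary
  derivative along one coordinate, the other inputs being held constant; no Frechet
  differentiability is implied.\<close>

definition slice :: "'n::finite \<Rightarrow> (real^'n \<Rightarrow> real) \<Rightarrow> real^'n \<Rightarrow> real \<Rightarrow> real" where
  "slice i \<phi> x t = \<phi> (\<chi> j. if j = i then t else x $ j)"

definition partial_deriv :: "'n::finite \<Rightarrow> (real^'n \<Rightarrow> real) \<Rightarrow> real^'n \<Rightarrow> real" where
  "partial_deriv i \<phi> x = deriv (slice i \<phi> x) (x $ i)"

definition formally_differentiable :: "(real^'n::finite \<Rightarrow> real) \<Rightarrow> real^'n \<Rightarrow> bool" where
  "formally_differentiable \<phi> x \<longleftrightarrow> (\<forall>i. slice i \<phi> x field_differentiable at (x $ i))"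

definition formal_grad :: "(real^'n::finite \<Rightarrow> real) \<Rightarrow> real^'n \<Rightarrow> real^'n" where
  "formal_grad \<phi> x = (\<chi> i. partial_deriv i \<phi> x)"

text \<open>\<open>second_partial i j \<phi>\<close> differentiates along \<open>j\<close> first and then along \<open>i\<close>;
  the two orders need not agree, as continuity of the second derivatives is not assumed.\<close>

definition second_partial :: "'n::finite \<Rightarrow> 'n \<Rightarrow> (real^'n \<Rightarrow> real) \<Rightarrow> real^'n \<Rightarrow> real" where
  "second_partial i j \<phi> = partial_deriv i (partial_deriv j \<phi>)"

definition dir_deriv :: "(real^'n::finite \<Rightarrow> real^'n) \<Rightarrow> (real^'n \<Rightarrow> real) \<Rightarrow> real^'n \<Rightarrow> real" where
  "dir_deriv X \<phi> x = X x \<bullet> formal_grad \<phi> x"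


section \<open>Random vectors\<close>

text \<open>On \<open>real^'n\<close> the order is componentwise, so this is the joint CDF; on \<open>real\<close> it is
  the usual CDF.\<close>

definition joint_cdf :: "'a measure \<Rightarrow> ('a \<Rightarrow> 'b::ordered_euclidean_space) \<Rightarrow> 'b \<Rightarrow> real" where
  "joint_cdf M X x = measure M {\<omega> \<in> space M. X \<omega> \<le> x}"

definition density_support :: "('b \<Rightarrow> real) \<Rightarrow> 'b set" where
  "density_support \<rho> = {x. \<rho> x > 0}"

definition continuous_with_density ::
    "'a measure \<Rightarrow> ('a \<Rightarrow> 'b::ordered_euclidean_space) \<Rightarrow> ('b \<Rightarrow> real) \<Rightarrow> bool" where
  "continuous_with_density M X \<rho> \<longleftrightarrow>
     continuous_on UNIV (joint_cdf M X) \<and>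
     (\<forall>x. 0 \<le> \<rho> x) \<and> open (density_support \<rho>) \<and>
     distributed M lborel X (\<lambda>x. ennreal (\<rho> x))"

definition coords :: "'n::finite set \<Rightarrow> real^'n \<Rightarrow> 'n \<Rightarrow> real" where
  "coords B x = restrict (\<lambda>i. x $ i) B"

definition independent_coords :: "'a measure \<Rightarrow> ('a \<Rightarrow> real^'n::finite) \<Rightarrow> 'n set \<Rightarrow> bool" where
  "independent_coords M X B \<longleftrightarrow>
     prob_space.indep_vars M (\<lambda>_. borel) (\<lambda>i \<omega>. X \<omega> $ i) B"

text \<open>The partition is \<open>\<pi> 1, \<dots>, \<pi> K\<close>; only \<open>\<pi> 1\<close> may be empty.\<close>

definition independent_blocks ::
    "'a measure \<Rightarrow> ('a \<Rightarrow> real^'n::finite) \<Rightarrow> nat \<Rightarrow> (nat \<Rightarrow> 'n set) \<Rightarrow> bool" where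
  "independent_blocks M X K \<pi> \<longleftrightarrow>
     1 \<le> K \<and> disjoint_family_on \<pi> {1..K} \<and> (\<Union>k\<in>{1..K}. \<pi> k) = UNIV \<and>
     prob_space.indep_vars M (\<lambda>k. PiM (\<pi> k) (\<lambda>_. borel)) (\<lambda>k \<omega>. coords (\<pi> k) (X \<omega>)) {1..K} \<and>
     independent_coords M X (\<pi> 1) \<and>
     (\<forall>k\<in>{2..K}. 2 \<le> card (\<pi> k) \<and> \<not> independent_coords M X (\<pi> k))"


section \<open>Dependency models\<close>

text \<open>The model of the block \<open>B\<close> with explanatory variable \<open>i \<in> B\<close>. The vector \<open>Z\<close> has
  \<open>card B - 1\<close> components, indexed by \<open>B - {i}\<close>, and takes its values in \<open>D\<close>. For a sample value
  \<open>x\<close> of \<open>X\<close> (a point of \<open>\<Omega>\<close>), the map \<open>z \<mapsto> r (x $ i) z\<close> on \<open>D\<close> is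
  injective and attains \<open>coords (B - {i}) x\<close>, so that its inverse there is well defined.\<close>

definition dependency_model ::
    "'a measure \<Rightarrow> ('a \<Rightarrow> real^'n::finite) \<Rightarrow> (real^'n) set \<Rightarrow> 'n set \<Rightarrow> 'n \<Rightarrow>
     ('n \<Rightarrow> real) set \<Rightarrow> (real \<Rightarrow> ('n \<Rightarrow> real) \<Rightarrow> 'n \<Rightarrow> real) \<Rightarrow> ('a \<Rightarrow> 'n \<Rightarrow> real) \<Rightarrow> bool" where
  "dependency_model M X \<Omega> B i D r Z \<longleftrightarrow>
     prob_space.indep_vars M (\<lambda>_. borel) (\<lambda>l \<omega>. Z \<omega> l) (B - {i}) \<and>
     prob_space.indep_var M
       (PiM {i} (\<lambda>_. borel)) (\<lambda>\<omega>. coords {i} (X \<omega>))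
       (PiM (B - {i}) (\<lambda>_. borel)) (\<lambda>\<omega>. restrict (Z \<omega>) (B - {i})) \<and>
     D \<subseteq> extensional (B - {i}) \<and>
     (AE \<omega> in M. restrict (Z \<omega>) (B - {i}) \<in> D \<and>
        coords (B - {i}) (X \<omega>) = r (X \<omega> $ i) (restrict (Z \<omega>) (B - {i}))) \<and>
     (\<forall>x\<in>\<Omega>. r (x $ i) \<in> D \<rightarrow> extensional (B - {i}) \<and> inj_on (r (x $ i)) D \<and>
        coords (B - {i}) x \<in> r (x $ i) ` D)"

definition twice_diff_explanatory ::
    "(real^'n::finite) set \<Rightarrow> 'n set \<Rightarrow> 'n \<Rightarrow> ('n \<Rightarrow> real) set \<Rightarrow>
     (real \<Rightarrow> ('n \<Rightarrow> real) \<Rightarrow> 'n \<Rightarrow> real) \<Rightarrow> bool" where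
  "twice_diff_explanatory \<Omega> B i D r \<longleftrightarrow>
     (\<forall>z\<in>D. \<forall>l\<in>B - {i}. \<forall>t\<in>(\<lambda>x. x $ i) ` \<Omega>.
        (\<lambda>s. r s z l) field_differentiable at t \<and>
        deriv (\<lambda>s. r s z l) field_differentiable at t)"

text \<open>Component \<open>l\<close> of the column \<open>J\<^sup>(\<^sup>i\<^sup>)\<close> of the block \<open>B\<close>.\<close>

definition dep_column ::
    "'n::finite set \<Rightarrow> 'n \<Rightarrow> ('n \<Rightarrow> real) set \<Rightarrow> (real \<Rightarrow> ('n \<Rightarrow> real) \<Rightarrow> 'n \<Rightarrow> real) \<Rightarrow>
     real^'n \<Rightarrow> 'n \<Rightarrow> real" where
  "dep_column B i D r x l =
     (if l = i then 1
      else deriv (\<lambda>t. r t (the_inv_into D (r (x $ i)) (coords (B - {i}) x)) l) (x $ i))"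

text \<open>The block-diagonal matrix, as the sum of its diagonal blocks extended by zero. Row \<open>l\<close>,
  column \<open>i\<close>.\<close>

definition dep_jacobian ::
    "nat \<Rightarrow> (nat \<Rightarrow> 'n::finite set) \<Rightarrow> ('n \<Rightarrow> ('n \<Rightarrow> real) set) \<Rightarrow>
     ('n \<Rightarrow> real \<Rightarrow> ('n \<Rightarrow> real) \<Rightarrow> 'n \<Rightarrow> real) \<Rightarrow> real^'n \<Rightarrow> real^'n^'n" where
  "dep_jacobian K \<pi> D r x =
     (\<chi> l i. (if i \<in> \<pi> 1 \<and> l = i then 1 else 0) +
        (\<Sum>k\<in>{2..K}. if l \<in> \<pi> k \<and> i \<in> \<pi> k then dep_column (\<pi> k) i (D i) (r i) x l else 0))"

definition induced_metric :: "(real^'n::finite \<Rightarrow> real^'n^'n) \<Rightarrow> real^'n \<Rightarrow> real^'n^'n" where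
  "induced_metric J x = transpose (J x) ** J x"


section \<open>Metric inverse and Christoffel symbols\<close>

definition moore_penrose :: "real^'n::finite^'n \<Rightarrow> real^'n^'n" where
  "moore_penrose A = (THE B. A ** B ** A = A \<and> B ** A ** B = B \<and>
     transpose (A ** B) = A ** B \<and> transpose (B ** A) = B ** A)"

definition metric_inverse :: "nat \<Rightarrow> real^'n::finite^'n \<Rightarrow> real^'n^'n" where
  "metric_inverse m A = (if m = CARD('n) then matrix_inv A else moore_penrose A)"

text \<open>\<open>christoffel H G k i j x\<close> is \<open>\<Gamma>\<^sup>k\<^sub>i\<^sub>j\<close> at \<open>x\<close>, with \<open>H\<close> in the role of the (generalized)
  inverse of \<open>G x\<close>.\<close>

definition christoffel ::
    "real^'n::finite^'n \<Rightarrow> (real^'n \<Rightarrow> real^'n^'n) \<Rightarrow> 'n \<Rightarrow> 'n \<Rightarrow> 'n \<Rightarrow> real^'n \<Rightarrow> real" where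
  "christoffel H G k i j x =
     1 / 2 * (\<Sum>l\<in>UNIV. H $ k $ l *
       (partial_deriv j (\<lambda>y. G y $ i $ l) x + partial_deriv i (\<lambda>y. G y $ j $ l) x
        - partial_deriv l (\<lambda>y. G y $ i $ j) x))"


section \<open>Levi-Civita connection\<close>

text \<open>Vector fields on \<open>U\<close> are total functions whose components are formally differentiable at every
  point of \<open>U\<close>; the values of a connection are only constrained on \<open>U\<close>.\<close>

definition scalar_field :: "(real^'n::finite) set \<Rightarrow> (real^'n \<Rightarrow> real) \<Rightarrow> bool" where
  "scalar_field U \<phi> \<longleftrightarrow> (\<forall>x\<in>U. formally_differentiable \<phi> x)"

definition vector_field :: "(real^'n::finite) set \<Rightarrow> (real^'n \<Rightarrow> real^'n) \<Rightarrow> bool" where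
  "vector_field U X \<longleftrightarrow> (\<forall>k. scalar_field U (\<lambda>x. X x $ k))"

type_synonym 'n connection =
  "(real^'n \<Rightarrow> real^'n) \<Rightarrow> (real^'n \<Rightarrow> real^'n) \<Rightarrow> real^'n \<Rightarrow> real^'n"

definition affine_connection :: "(real^'n::finite) set \<Rightarrow> 'n connection \<Rightarrow> bool" where
  "affine_connection U nabla \<longleftrightarrow>
     (\<forall>X X' Y \<phi>. vector_field U X \<longrightarrow> vector_field U X' \<longrightarrow> vector_field U Y \<longrightarrow> scalar_field U \<phi> \<longrightarrow>
       (\<forall>x\<in>U.
          nabla (\<lambda>y. X y + X' y) Y x = nabla X Y x + nabla X' Y x \<and>
          nabla (\<lambda>y. \<phi> y *\<^sub>R X y) Y x = \<phi> x *\<^sub>R nabla X Y x)) \<and>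
     (\<forall>X Y Y' \<phi>. vector_field U X \<longrightarrow> vector_field U Y \<longrightarrow> vector_field U Y' \<longrightarrow> scalar_field U \<phi> \<longrightarrow>
       (\<forall>x\<in>U.
          nabla X (\<lambda>y. Y y + Y' y) x = nabla X Y x + nabla X Y' x \<and>
          nabla X (\<lambda>y. \<phi> y *\<^sub>R Y y) x = dir_deriv X \<phi> x *\<^sub>R Y x + \<phi> x *\<^sub>R nabla X Y x))"

definition lie_bracket :: "(real^'n::finite \<Rightarrow> real^'n) \<Rightarrow> (real^'n \<Rightarrow> real^'n) \<Rightarrow> real^'n \<Rightarrow> real^'n" where
  "lie_bracket X Y x = (\<chi> k. dir_deriv X (\<lambda>y. Y y $ k) x - dir_deriv Y (\<lambda>y. X y $ k) x)"

definition torsion_free :: "(real^'n::finite) set \<Rightarrow> 'n connection \<Rightarrow> bool" where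
  "torsion_free U nabla \<longleftrightarrow>
     (\<forall>X Y. vector_field U X \<longrightarrow> vector_field U Y \<longrightarrow>
       (\<forall>x\<in>U. nabla X Y x - nabla Y X x = lie_bracket X Y x))"

definition metric_compatible ::
    "(real^'n::finite) set \<Rightarrow> (real^'n \<Rightarrow> real^'n^'n) \<Rightarrow> 'n connection \<Rightarrow> bool" where
  "metric_compatible U G nabla \<longleftrightarrow>
     (\<forall>X Y Z. vector_field U X \<longrightarrow> vector_field U Y \<longrightarrow> vector_field U Z \<longrightarrow>
       (\<forall>x\<in>U. dir_deriv X (\<lambda>y. Y y \<bullet> (G y *v Z y)) x =
          nabla X Y x \<bullet> (G x *v Z x) + Y x \<bullet> (G x *v nabla X Z x)))"

text \<open>The Levi-Civita connection is unique as an operator on vector fields on \<open>U\<close>; the choice only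
  concerns its irrelevant values outside \<open>U\<close> and on other functions.\<close>

definition levi_civita ::
    "(real^'n::finite) set \<Rightarrow> (real^'n \<Rightarrow> real^'n^'n) \<Rightarrow> 'n connection" where
  "levi_civita U G = (SOME nabla. affine_connection U nabla \<and> torsion_free U nabla \<and>
     metric_compatible U G nabla)"

definition second_covariant_deriv ::
    "'n::finite connection \<Rightarrow> (real^'n \<Rightarrow> real) \<Rightarrow> (real^'n \<Rightarrow> real^'n) \<Rightarrow> (real^'n \<Rightarrow> real^'n) \<Rightarrow>
     real^'n \<Rightarrow> real" where
  "second_covariant_deriv nabla f X Y x =
     dir_deriv X (dir_deriv Y f) x - dir_deriv (nabla X Y) f x"


section \<open>Riemannian gradient and Hessian\<close>

definition coord_field :: "'n::finite \<Rightarrow> real^'n \<Rightarrow> real^'n" where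
  "coord_field i = (\<lambda>_. axis i 1)"

text \<open>Where \<open>G\<close> is degenerate, gradient and Hessian are by convention the coordinate expressions
  with the generalized inverse.\<close>

definition riem_grad :: "(real^'n::finite \<Rightarrow> real^'n^'n) \<Rightarrow> (real^'n \<Rightarrow> real) \<Rightarrow> real^'n \<Rightarrow> real^'n" where
  "riem_grad G f x =
     (if invertible (G x) then THE w. \<forall>v. v \<bullet> (G x *v w) = formal_grad f x \<bullet> v
      else moore_penrose (G x) *v formal_grad f x)"

text \<open>The connection is that of the part of \<open>\<Omega>\<close> on which \<open>G\<close> is nondegenerate.\<close>

definition riem_hess ::
    "(real^'n::finite) set \<Rightarrow> (real^'n \<Rightarrow> real^'n^'n) \<Rightarrow> (real^'n \<Rightarrow> real) \<Rightarrow> real^'n \<Rightarrow> real^'n^'n" where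
  "riem_hess \<Omega> G f x = (\<chi> i j.
     if invertible (G x) then
       second_covariant_deriv (levi_civita {y \<in> \<Omega>. invertible (G y)} G) f
         (coord_field i) (coord_field j) x
     else second_partial i j f x
       - (\<Sum>k\<in>UNIV. christoffel (moore_penrose (G x)) G k i j x * partial_deriv k f x))"

end

theory Submission
  imports Defs
begin

text \<open>The determinant of \<open>G = J\<^sup>T J\<close> is the square of that of \<open>J\<close>, so the rank condition
  selects the same inverse as the nondegeneracy of \<open>G\<close>, and the degenerate case holds by
  convention. If \<open>G x\<close> is invertible, metric compatibility and vanishing torsion on coordinate
  fields determine \<open>G (\<nabla>\<^sub>i e\<^sub>j)\<close> by Koszul's formula, so \<open>\<nabla>\<^sub>i e\<^sub>j\<close> has the Christoffel
  symbols as components; the connection defined by those symbols shows that a Levi-Civita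
  connection exists.\<close>

section \<open>Calculus of formal derivatives\<close>

lemma slice_self [simp]: "slice i \<phi> x (x $ i) = \<phi> x"
proof -
  have "(\<chi> j. if j = i then x $ i else x $ j) = x"
    by (simp add: vec_eq_iff)
  then show ?thesis
    by (simp add: slice_def)
qed

lemma formally_differentiable_DERIV:
  "formally_differentiable \<phi> x \<Longrightarrow>
     (slice i \<phi> x has_field_derivative partial_deriv i \<phi> x) (at (x $ i))"
  by (simp add: formally_differentiable_def partial_deriv_def DERIV_deriv_iff_field_differentiable)

lemma formally_differentiableI:
  "(\<And>i. (slice i \<phi> x has_field_derivative d i) (at (x $ i))) \<Longrightarrow> formally_differentiable \<phi> x"
  by (auto simp: formally_differentiable_def field_differentiable_def)

lemma partial_derivI:
  "(slice i \<phi> x has_field_derivative d) (at (x $ i)) \<Longrightarrow> partial_deriv i \<phi> x = d"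
  by (simp add: partial_deriv_def DERIV_imp_deriv)

text \<open>The slice rules use \<open>has_field_derivative\<close> so that each one yields both
  formal differentiability (through \<open>formally_differentiableI\<close>) and the value of the
  partial derivative (through \<open>partial_derivI\<close>).\<close>

lemma slice_const_DERIV: "(slice i (\<lambda>_. c) x has_field_derivative 0) (at (x $ i))"
proof -
  have "slice i (\<lambda>_. c) x = (\<lambda>_. c)"
    by (simp add: slice_def fun_eq_iff)
  then show ?thesis
    by simp
qed

lemma slice_add_DERIV:
  assumes "formally_differentiable \<phi> x" "formally_differentiable \<psi> x"
  shows "(slice i (\<lambda>y. \<phi> y + \<psi> y) x has_field_derivative
           partial_deriv i \<phi> x + partial_deriv i \<psi> x) (at (x $ i))"
proof -
  have "slice i (\<lambda>y. \<phi> y + \<psi> y) x = (\<lambda>t. slice i \<phi> x t + slice i \<psi> x t)"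
    by (simp add: slice_def fun_eq_iff)
  then show ?thesis
    using assms by (auto intro!: derivative_eq_intros formally_differentiable_DERIV)
qed

lemma slice_mult_DERIV:
  assumes "formally_differentiable \<phi> x" "formally_differentiable \<psi> x"
  shows "(slice i (\<lambda>y. \<phi> y * \<psi> y) x has_field_derivative
           partial_deriv i \<phi> x * \<psi> x + \<phi> x * partial_deriv i \<psi> x) (at (x $ i))"
proof -
  have "slice i (\<lambda>y. \<phi> y * \<psi> y) x = (\<lambda>t. slice i \<phi> x t * slice i \<psi> x t)"
    by (simp add: slice_def fun_eq_iff)
  then show ?thesis
    using DERIV_mult[OF assms[THEN formally_differentiable_DERIV, of i]]
    by (simp add: mult.commute)
qed

lemma slice_sum_DERIV:
  assumes "\<And>a. a \<in> A \<Longrightarrow> formally_differentiable (\<phi> a) x"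
  shows "(slice i (\<lambda>y. \<Sum>a\<in>A. \<phi> a y) x has_field_derivative
           (\<Sum>a\<in>A. partial_deriv i (\<phi> a) x)) (at (x $ i))"
proof -
  have "slice i (\<lambda>y. \<Sum>a\<in>A. \<phi> a y) x = (\<lambda>t. \<Sum>a\<in>A. slice i (\<phi> a) x t)"
    by (simp add: slice_def fun_eq_iff)
  then show ?thesis
    using assms by (auto intro!: DERIV_sum formally_differentiable_DERIV)
qed

lemmas formally_differentiable_const = formally_differentiableI[OF slice_const_DERIV]

lemma formally_differentiable_mult:
  assumes "formally_differentiable \<phi> x" "formally_differentiable \<psi> x"
  shows "formally_differentiable (\<lambda>y. \<phi> y * \<psi> y) x"
  by (rule formally_differentiableI[OF slice_mult_DERIV[OF assms]])

lemma formally_differentiable_sum: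
  assumes "\<And>a. a \<in> A \<Longrightarrow> formally_differentiable (\<phi> a) x"
  shows "formally_differentiable (\<lambda>y. \<Sum>a\<in>A. \<phi> a y) x"
  by (rule formally_differentiableI[OF slice_sum_DERIV[OF assms]])

lemmas partial_deriv_const = partial_derivI[OF slice_const_DERIV]
lemmas partial_deriv_add = partial_derivI[OF slice_add_DERIV]
lemmas partial_deriv_mult = partial_derivI[OF slice_mult_DERIV]
lemmas partial_deriv_sum = partial_derivI[OF slice_sum_DERIV]

section \<open>Directional derivatives along vector fields\<close>

lemma dir_deriv_eq_sum: "dir_deriv X \<phi> x = (\<Sum>i\<in>UNIV. X x $ i * partial_deriv i \<phi> x)"
  by (simp add: dir_deriv_def formal_grad_def inner_vec_def)

lemma dir_deriv_const: "dir_deriv X (\<lambda>_. c) x = 0"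
  by (simp add: dir_deriv_eq_sum partial_deriv_const)

lemma dir_deriv_add:
  assumes "formally_differentiable \<phi> x" "formally_differentiable \<psi> x"
  shows "dir_deriv X (\<lambda>y. \<phi> y + \<psi> y) x = dir_deriv X \<phi> x + dir_deriv X \<psi> x"
  by (simp add: dir_deriv_eq_sum partial_deriv_add[OF assms] distrib_left sum.distrib)

text \<open>\<open>dir_deriv\<close> is a combination of partial derivatives with coefficients fixed
  at \<open>x\<close>, so the Leibniz rule is inherited from one-variable calculus, coordinate by
  coordinate.\<close>

lemma dir_deriv_mult:
  assumes "formally_differentiable \<phi> x" "formally_differentiable \<psi> x"
  shows "dir_deriv X (\<lambda>y. \<phi> y * \<psi> y) x = dir_deriv X \<phi> x * \<psi> x + \<phi> x * dir_deriv X \<psi> x"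
  by (simp add: dir_deriv_eq_sum partial_deriv_mult[OF assms] distrib_left sum.distrib
      sum_distrib_left sum_distrib_right mult_ac)

lemma dir_deriv_sum:
  assumes "\<And>a. a \<in> A \<Longrightarrow> formally_differentiable (\<phi> a) x"
  shows "dir_deriv X (\<lambda>y. \<Sum>a\<in>A. \<phi> a y) x = (\<Sum>a\<in>A. dir_deriv X (\<phi> a) x)"
proof -
  have "dir_deriv X (\<lambda>y. \<Sum>a\<in>A. \<phi> a y) x =
      (\<Sum>i\<in>UNIV. \<Sum>a\<in>A. X x $ i * partial_deriv i (\<phi> a) x)"
    by (simp add: dir_deriv_eq_sum partial_deriv_sum[OF assms] sum_distrib_left)
  also have "\<dots> = (\<Sum>a\<in>A. \<Sum>i\<in>UNIV. X x $ i * partial_deriv i (\<phi> a) x)"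
    by (rule sum.swap)
  finally show ?thesis
    by (simp add: dir_deriv_eq_sum)
qed

lemma dir_deriv_coord_field: "dir_deriv (coord_field i) \<phi> x = partial_deriv i \<phi> x"
  by (simp add: dir_deriv_def coord_field_def formal_grad_def inner_axis')

lemma vector_field_coord_field: "vector_field U (coord_field i)"
  by (simp add: vector_field_def scalar_field_def coord_field_def formally_differentiable_const)

lemma vector_fieldD:
  "vector_field U X \<Longrightarrow> x \<in> U \<Longrightarrow> formally_differentiable (\<lambda>y. X y $ k) x"
  by (simp add: vector_field_def scalar_field_def)


section \<open>The connection defined by the Christoffel symbols\<close>

lemma inner_matrix_vector_eq_sum:
  fixes A :: "real^'n::finite^'n"
  shows "v \<bullet> (A *v w) = (\<Sum>a\<in>UNIV. \<Sum>b\<in>UNIV. v $ a * (A $ a $ b * w $ b))"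
  by (simp add: inner_vec_def matrix_vector_mult_def sum_distrib_left)

lemma symmetric_inner_matrix_vector:
  fixes A :: "real^'n::finite^'n"
  assumes "transpose A = A"
  shows "v \<bullet> (A *v w) = w \<bullet> (A *v v)"
  by (metis assms dot_lmul_matrix inner_commute matrix_transpose_mul transpose_matrix_vector)

text \<open>The Christoffel symbol of the first kind, with \<open>l\<close> the lowered
  index.\<close>

definition christoffel_first ::
    "(real^'n::finite \<Rightarrow> real^'n^'n) \<Rightarrow> 'n \<Rightarrow> 'n \<Rightarrow> 'n \<Rightarrow> real^'n \<Rightarrow> real" where
  "christoffel_first G l i j x =
     1 / 2 * (partial_deriv j (\<lambda>y. G y $ i $ l) x + partial_deriv i (\<lambda>y. G y $ j $ l) x
        - partial_deriv l (\<lambda>y. G y $ i $ j) x)"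

lemma christoffel_eq_first:
  "christoffel H G k i j x = (\<Sum>l\<in>UNIV. H $ k $ l * christoffel_first G l i j x)"
  by (simp add: christoffel_def christoffel_first_def sum_distrib_left sum_divide_distrib)

text \<open>The non-derivative part of the connection, bilinear in \<open>u\<close> and
  \<open>v\<close>. The index is raised last, by one application of the inverse matrix, so that
  multiplying by \<open>G x\<close> cancels it.\<close>

definition christoffel_form ::
    "(real^'n::finite \<Rightarrow> real^'n^'n) \<Rightarrow> real^'n \<Rightarrow> real^'n \<Rightarrow> real^'n \<Rightarrow> real^'n" where
  "christoffel_form G x u v = matrix_inv (G x) *v
     (\<chi> l. \<Sum>i\<in>UNIV. \<Sum>j\<in>UNIV. u $ i * v $ j * christoffel_first G l i j x)"

definition christoffel_connection :: "(real^'n::finite \<Rightarrow> real^'n^'n) \<Rightarrow> 'n connection" where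
  "christoffel_connection G X Y x =
     (\<chi> k. dir_deriv X (\<lambda>y. Y y $ k) x) + christoffel_form G x (X x) (Y x)"

lemma matrix_inv_cancel:
  fixes A :: "real^'n::finite^'n"
  assumes "invertible A"
  shows "A *v (matrix_inv A *v v) = v" "matrix_inv A *v (A *v v) = v"
proof -
  have "A ** matrix_inv A = mat 1 \<and> matrix_inv A ** A = mat 1"
    unfolding matrix_inv_def by (rule someI_ex) (use assms in \<open>simp add: invertible_def\<close>)
  then show "A *v (matrix_inv A *v v) = v" "matrix_inv A *v (A *v v) = v"
    by (simp_all add: matrix_vector_mul_assoc)
qed

lemma christoffel_form_add_left:
  "christoffel_form G x (u + u') v = christoffel_form G x u v + christoffel_form G x u' v"
  \<comment> \<open>Linearity of the matrix collects both sides under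
    \<open>matrix_inv (G x)\<close>, which leaves an identity between vectors of lowered
    components.\<close>
  unfolding christoffel_form_def matrix_vector_right_distrib[symmetric]
  by (rule arg_cong[where f = "(*v) _"])
     (simp add: vec_eq_iff algebra_simps sum.distrib)

lemma christoffel_form_add_right:
  "christoffel_form G x u (v + v') = christoffel_form G x u v + christoffel_form G x u v'"
  unfolding christoffel_form_def matrix_vector_right_distrib[symmetric]
  by (rule arg_cong[where f = "(*v) _"])
     (simp add: vec_eq_iff algebra_simps sum.distrib)

lemma christoffel_form_scaleR_left:
  "christoffel_form G x (c *\<^sub>R u) v = c *\<^sub>R christoffel_form G x u v"
  unfolding christoffel_form_def matrix_vector_mult_scaleR[symmetric]
  by (rule arg_cong[where f = "(*v) _"])
     (simp add: vec_eq_iff sum_distrib_left mult_ac)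

lemma christoffel_form_scaleR_right:
  "christoffel_form G x u (c *\<^sub>R v) = c *\<^sub>R christoffel_form G x u v"
  unfolding christoffel_form_def matrix_vector_mult_scaleR[symmetric]
  by (rule arg_cong[where f = "(*v) _"])
     (simp add: vec_eq_iff sum_distrib_left mult_ac)

text \<open>The derivative part is linear in the value \<open>X x\<close> and obeys the Leibniz rule
  in \<open>Y\<close>; the remaining part is bilinear at each point.\<close>

lemma affine_christoffel_connection: "affine_connection U (christoffel_connection G)"
  unfolding affine_connection_def
proof (intro conjI allI impI ballI)
  fix X X' Y :: "real^'a \<Rightarrow> real^'a" and \<phi> x
  show "christoffel_connection G (\<lambda>y. X y + X' y) Y x =
      christoffel_connection G X Y x + christoffel_connection G X' Y x"
    by (simp add: christoffel_connection_def christoffel_form_add_left dir_deriv_def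
        inner_add_left vec_eq_iff)
  show "christoffel_connection G (\<lambda>y. \<phi> y *\<^sub>R X y) Y x = \<phi> x *\<^sub>R christoffel_connection G X Y x"
    by (simp add: christoffel_connection_def christoffel_form_scaleR_left dir_deriv_def
        vec_eq_iff algebra_simps)
next
  fix X Y Y' :: "real^'a \<Rightarrow> real^'a" and \<phi> x
  assume fields: "vector_field U Y" "vector_field U Y'" "scalar_field U \<phi>" and "x \<in> U"
  then have diff: "formally_differentiable (\<lambda>y. Y y $ k) x"
      "formally_differentiable (\<lambda>y. Y' y $ k) x" "formally_differentiable \<phi> x" for k
    by (simp_all add: vector_field_def scalar_field_def)
  show "christoffel_connection G X (\<lambda>y. Y y + Y' y) x =
      christoffel_connection G X Y x + christoffel_connection G X Y' x"
    by (simp add: christoffel_connection_def christoffel_form_add_right vec_eq_iff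
        dir_deriv_add[OF diff(1,2)])
  show "christoffel_connection G X (\<lambda>y. \<phi> y *\<^sub>R Y y) x =
      dir_deriv X \<phi> x *\<^sub>R Y x + \<phi> x *\<^sub>R christoffel_connection G X Y x"
    by (simp add: christoffel_connection_def christoffel_form_scaleR_right vec_eq_iff
        dir_deriv_mult[OF diff(3,1)] algebra_simps)
qed

text \<open>The first identity is vanishing torsion in components, the second is metric
  compatibility: the derivatives along \<open>j\<close> and \<open>l\<close> cancel, and the two
  along \<open>i\<close> agree by symmetry of \<open>G\<close>.\<close>

lemma christoffel_first_commute:
  fixes G :: "real^'n::finite \<Rightarrow> real^'n^'n"
  assumes sym: "\<And>y. transpose (G y) = G y"
  shows "christoffel_first G l i j x = christoffel_first G l j i x"
    and "christoffel_first G l i j x + christoffel_first G j i l x =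
           partial_deriv i (\<lambda>y. G y $ j $ l) x"
proof -
  have "G y $ a $ b = G y $ b $ a" for y a b
    by (metis sym transpose_def vec_lambda_beta)
  \<comment> \<open>Symmetry at every point gives equality of the entry functions, hence of their
    partial derivatives.\<close>
  then have swap: "(\<lambda>y. G y $ a $ b) = (\<lambda>y. G y $ b $ a)" for a b
    by blast
  show "christoffel_first G l i j x = christoffel_first G l j i x"
    by (simp add: christoffel_first_def swap[of j i])
  show "christoffel_first G l i j x + christoffel_first G j i l x =
      partial_deriv i (\<lambda>y. G y $ j $ l) x"
    by (simp add: christoffel_first_def swap[of l j] field_simps)
qed

text \<open>The derivative parts of the two terms differ by the Lie bracket, so it remains to see
  that \<open>christoffel_form\<close> is symmetric.\<close>

lemma torsion_free_christoffel_connection: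
  fixes G :: "real^'n::finite \<Rightarrow> real^'n^'n"
  assumes sym: "\<And>y. transpose (G y) = G y"
  shows "torsion_free U (christoffel_connection G)"
proof -
  have "christoffel_form G x u v = christoffel_form G x v u" for x u v
  proof -
    have "(\<Sum>i\<in>UNIV. \<Sum>j\<in>UNIV. u $ i * v $ j * christoffel_first G l i j x) =
        (\<Sum>i\<in>UNIV. \<Sum>j\<in>UNIV. v $ i * u $ j * christoffel_first G l i j x)" for l
      by (subst sum.swap) (simp add: christoffel_first_commute(1)[where G = G and l = l, OF sym] mult_ac)
    then show ?thesis
      by (simp add: christoffel_form_def)
  qed
  then show ?thesis
    by (simp add: torsion_free_def christoffel_connection_def lie_bracket_def vec_eq_iff)
qed

lemma inner_christoffel_form:
  assumes "invertible (G x)"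
  shows "w \<bullet> (G x *v christoffel_form G x u v) =
    (\<Sum>i\<in>UNIV. \<Sum>j\<in>UNIV. \<Sum>l\<in>UNIV. u $ i * v $ j * w $ l * christoffel_first G l i j x)"
proof -
  have "w \<bullet> (G x *v christoffel_form G x u v) =
      (\<Sum>l\<in>UNIV. \<Sum>i\<in>UNIV. \<Sum>j\<in>UNIV. u $ i * v $ j * w $ l * christoffel_first G l i j x)"
    by (simp add: christoffel_form_def matrix_inv_cancel[OF assms] inner_vec_def
        sum_distrib_left mult_ac)
  also have "\<dots> =
      (\<Sum>i\<in>UNIV. \<Sum>l\<in>UNIV. \<Sum>j\<in>UNIV. u $ i * v $ j * w $ l * christoffel_first G l i j x)"
    by (rule sum.swap)
  also have "\<dots> =
      (\<Sum>i\<in>UNIV. \<Sum>j\<in>UNIV. \<Sum>l\<in>UNIV. u $ i * v $ j * w $ l * christoffel_first G l i j x)"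
    by (intro sum.cong refl sum.swap)
  finally show ?thesis .
qed

text \<open>The product rule on the double sum of \<open>Y\<close>, \<open>G\<close> and
  \<open>Z\<close> entries; the last term isolates the derivative of the metric, which the
  Christoffel terms must match.\<close>

lemma dir_deriv_metric:
  fixes G :: "real^'n::finite \<Rightarrow> real^'n^'n"
  assumes Y: "\<And>k. formally_differentiable (\<lambda>y. Y y $ k) x"
    and Z: "\<And>k. formally_differentiable (\<lambda>y. Z y $ k) x"
    and G: "\<And>i j. formally_differentiable (\<lambda>y. G y $ i $ j) x"
  shows "dir_deriv X (\<lambda>y. Y y \<bullet> (G y *v Z y)) x =
    (\<chi> k. dir_deriv X (\<lambda>y. Y y $ k) x) \<bullet> (G x *v Z x)
    + Y x \<bullet> (G x *v (\<chi> k. dir_deriv X (\<lambda>y. Z y $ k) x))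
    + (\<Sum>a\<in>UNIV. \<Sum>b\<in>UNIV. Y x $ a * Z x $ b * dir_deriv X (\<lambda>y. G y $ a $ b) x)"
proof -
  have "dir_deriv X (\<lambda>y. Y y \<bullet> (G y *v Z y)) x = (\<Sum>a\<in>UNIV. \<Sum>b\<in>UNIV.
      dir_deriv X (\<lambda>y. Y y $ a) x * (G x $ a $ b * Z x $ b)
      + Y x $ a * (dir_deriv X (\<lambda>y. G y $ a $ b) x * Z x $ b
          + G x $ a $ b * dir_deriv X (\<lambda>y. Z y $ b) x))"
    unfolding inner_matrix_vector_eq_sum
    by (simp add: dir_deriv_sum dir_deriv_mult formally_differentiable_sum
        formally_differentiable_mult Y Z G)
  then show ?thesis
    by (simp add: inner_matrix_vector_eq_sum distrib_left sum.distrib mult_ac)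
qed

lemma metric_compatible_christoffel_connection:
  fixes G :: "real^'n::finite \<Rightarrow> real^'n^'n"
  assumes sym: "\<And>y. transpose (G y) = G y"
    and diff: "\<And>i j y. y \<in> U \<Longrightarrow> formally_differentiable (\<lambda>y. G y $ i $ j) y"
    and inv: "\<And>y. y \<in> U \<Longrightarrow> invertible (G y)"
  shows "metric_compatible U G (christoffel_connection G)"
  unfolding metric_compatible_def
proof (intro allI impI ballI)
  fix X Y Z :: "real^'n \<Rightarrow> real^'n" and x
  assume Y: "vector_field U Y" and Z: "vector_field U Z" and x: "x \<in> U"
  let ?S = "\<lambda>l i j. christoffel_first G l i j x"
  \<comment> \<open>Symmetry of \<open>G x\<close> moves the first \<open>christoffel_form\<close>
    to the right of the product, so that both terms become trilinear sums. In the second one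
    \<open>Z\<close> is the differentiated field, and the lowered index is therefore
    \<open>j\<close>.\<close>
  have "christoffel_form G x (X x) (Y x) \<bullet> (G x *v Z x)
      + Y x \<bullet> (G x *v christoffel_form G x (X x) (Z x)) =
      (\<Sum>i\<in>UNIV. \<Sum>j\<in>UNIV. \<Sum>l\<in>UNIV. X x $ i * Y x $ j * Z x $ l * ?S l i j)
      + (\<Sum>i\<in>UNIV. \<Sum>l\<in>UNIV. \<Sum>j\<in>UNIV. X x $ i * Z x $ l * Y x $ j * ?S j i l)"
    by (simp only: symmetric_inner_matrix_vector[OF sym, of "christoffel_form G x (X x) (Y x)"]
        inner_christoffel_form[where G = G, OF inv[OF x]])
  also have "\<dots> = (\<Sum>i\<in>UNIV. \<Sum>j\<in>UNIV. \<Sum>l\<in>UNIV.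
      X x $ i * Y x $ j * Z x $ l * (?S l i j + ?S j i l))"
  proof -
    have "(\<Sum>l\<in>UNIV. \<Sum>j\<in>UNIV. X x $ i * Z x $ l * Y x $ j * ?S j i l) =
        (\<Sum>j\<in>UNIV. \<Sum>l\<in>UNIV. X x $ i * Y x $ j * Z x $ l * ?S j i l)" for i
      by (subst sum.swap) (simp add: mult_ac)
    then show ?thesis
      by (simp add: distrib_left sum.distrib)
  qed
  also have "\<dots> = (\<Sum>j\<in>UNIV. \<Sum>l\<in>UNIV. \<Sum>i\<in>UNIV.
      X x $ i * Y x $ j * Z x $ l * partial_deriv i (\<lambda>y. G y $ j $ l) x)"
    \<comment> \<open>The sum over \<open>i\<close> is moved innermost, where it becomes a
      derivative along \<open>X\<close>.\<close>
    unfolding christoffel_first_commute(2)[OF sym]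
    by (subst sum.swap) (intro sum.cong refl sum.swap)
  also have "\<dots> =
      (\<Sum>j\<in>UNIV. \<Sum>l\<in>UNIV. Y x $ j * Z x $ l * dir_deriv X (\<lambda>y. G y $ j $ l) x)"
    by (simp add: dir_deriv_eq_sum sum_distrib_left mult_ac)
  finally show "dir_deriv X (\<lambda>y. Y y \<bullet> (G y *v Z y)) x =
      christoffel_connection G X Y x \<bullet> (G x *v Z x)
      + Y x \<bullet> (G x *v christoffel_connection G X Z x)"
    by (simp add: dir_deriv_metric[OF vector_fieldD[OF Y x] vector_fieldD[OF Z x] diff[OF x]]
        christoffel_connection_def inner_add_left inner_add_right matrix_vector_right_distrib)
qed


section \<open>Koszul's formula\<close>

text \<open>The choice in \<open>levi_civita\<close> is meaningful once a witness exists, here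
  \<open>christoffel_connection\<close>. The two properties recorded are those that Koszul's formula
  combines.\<close>

lemma levi_civita_props:
  fixes G :: "real^'n::finite \<Rightarrow> real^'n^'n"
  assumes "\<And>y. transpose (G y) = G y"
    and "\<And>i j y. y \<in> U \<Longrightarrow> formally_differentiable (\<lambda>y. G y $ i $ j) y"
    and "\<And>y. y \<in> U \<Longrightarrow> invertible (G y)"
  shows "torsion_free U (levi_civita U G)" "metric_compatible U G (levi_civita U G)"
proof -
  have "\<exists>nabla. affine_connection U nabla \<and> torsion_free U nabla \<and> metric_compatible U G nabla"
    by (intro exI[of _ "christoffel_connection G"] conjI affine_christoffel_connection
        torsion_free_christoffel_connection metric_compatible_christoffel_connection assms)
  from someI_ex[OF this]
  show "torsion_free U (levi_civita U G)" "metric_compatible U G (levi_civita U G)"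
    by (simp_all add: levi_civita_def)
qed

text \<open>Compatibility, applied to three coordinate fields in permuted order, expresses
  derivatives of \<open>G\<close> through lowered components of \<open>nabla\<close>; vanishing
  torsion lets the system be solved.\<close>

lemma connection_coord_field:
  fixes G :: "real^'n::finite \<Rightarrow> real^'n^'n"
  assumes sym: "\<And>y. transpose (G y) = G y"
    and inv: "invertible (G x)" and x: "x \<in> U"
    and tf: "torsion_free U nabla" and mc: "metric_compatible U G nabla"
  shows "nabla (coord_field i) (coord_field j) x $ k = christoffel (matrix_inv (G x)) G k i j x"
proof -
  define N where "N a b = nabla (coord_field a) (coord_field b) x" for a b
  have entry: "coord_field b y \<bullet> (G y *v v) = (G y *v v) $ b" for b y v
    by (simp add: coord_field_def inner_axis')
  \<comment> \<open>Coordinate fields have constant components.\<close>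
  have "lie_bracket (coord_field a) (coord_field b) x = 0" for a b
    by (simp add: lie_bracket_def dir_deriv_const coord_field_def vec_eq_iff)
  moreover have "N a b - N b a = lie_bracket (coord_field a) (coord_field b) x" for a b
    using tf x by (simp add: N_def torsion_free_def vector_field_coord_field)
  ultimately have N_sym: "N a b = N b a" for a b
    by simp
  have partial: "partial_deriv a (\<lambda>y. G y $ b $ c) x = (G x *v N a b) $ c + (G x *v N a c) $ b"
    for a b c
  proof -
    have "dir_deriv (coord_field a) (\<lambda>y. coord_field b y \<bullet> (G y *v coord_field c y)) x =
        N a b \<bullet> (G x *v coord_field c x) + coord_field b x \<bullet> (G x *v N a c)"
      using mc x unfolding N_def by (simp add: metric_compatible_def vector_field_coord_field)
    moreover have "(\<lambda>y. coord_field b y \<bullet> (G y *v coord_field c y)) = (\<lambda>y. G y $ b $ c)"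
      unfolding entry
      by (simp add: coord_field_def fun_eq_iff matrix_vector_mul_component inner_axis)
    ultimately show ?thesis
      by (simp add: dir_deriv_coord_field entry
          symmetric_inner_matrix_vector[OF sym, of "N a b"])
  qed
  \<comment> \<open>Substituting \<open>partial\<close> gives six terms: by \<open>N_sym\<close>
    four cancel in pairs and the other two coincide, absorbing the factor 1/2.\<close>
  have "christoffel_first G l i j x = (G x *v N i j) $ l" for l
    by (simp add: christoffel_first_def partial N_sym[of j i] N_sym[of l])
  then have "christoffel (matrix_inv (G x)) G k i j x = (matrix_inv (G x) *v (G x *v N i j)) $ k"
    by (simp add: christoffel_eq_first matrix_vector_mult_def)
  then show ?thesis
    by (simp add: matrix_inv_cancel[OF inv] N_def)
qed

text \<open>The field in the second slot acts on \<open>f\<close> first, which fixes the order of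
  differentiation in \<open>second_partial\<close>.\<close>

lemma second_covariant_deriv_coord_field:
  "second_covariant_deriv nabla f (coord_field i) (coord_field j) x =
     second_partial i j f x
     - (\<Sum>k\<in>UNIV. nabla (coord_field i) (coord_field j) x $ k * partial_deriv k f x)"
proof -
  have "dir_deriv (coord_field j) f = partial_deriv j f"
    by (simp add: fun_eq_iff dir_deriv_coord_field)
  then show ?thesis
    by (simp add: second_covariant_deriv_def dir_deriv_coord_field second_partial_def)
       (simp add: dir_deriv_eq_sum)
qed

section \<open>Hessian and gradient at nondegenerate points\<close>

lemma riem_hess_nondegenerate:
  fixes G :: "real^'n::finite \<Rightarrow> real^'n^'n"
  assumes sym: "\<And>y. transpose (G y) = G y"
    and diff: "\<And>i j y. y \<in> \<Omega> \<Longrightarrow> formally_differentiable (\<lambda>y. G y $ i $ j) y"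
    and inv: "invertible (G x)" and x: "x \<in> \<Omega>"
  shows "riem_hess \<Omega> G f x $ i $ j = second_partial i j f x
    - (\<Sum>k\<in>UNIV. christoffel (matrix_inv (G x)) G k i j x * partial_deriv k f x)"
proof -
  \<comment> \<open>The set used in \<open>riem_hess\<close>: \<open>G\<close> is invertible
    throughout it, as \<open>levi_civita_props\<close> requires, and it contains
    \<open>x\<close>.\<close>
  let ?U = "{y \<in> \<Omega>. invertible (G y)}"
  have "torsion_free ?U (levi_civita ?U G)" "metric_compatible ?U G (levi_civita ?U G)"
    by (rule levi_civita_props; use sym diff in simp)+
  then have "levi_civita ?U G (coord_field i) (coord_field j) x $ k =
      christoffel (matrix_inv (G x)) G k i j x" for k
    by (intro connection_coord_field[where U = ?U] sym inv) (use inv x in simp)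
  then show ?thesis
    using inv by (simp add: riem_hess_def second_covariant_deriv_coord_field)
qed

text \<open>Testing against all \<open>v\<close> amounts to the linear system with matrix
  \<open>G x\<close>, whose unique solution settles the definite description.\<close>

lemma riem_grad_nondegenerate:
  fixes G :: "real^'n::finite \<Rightarrow> real^'n^'n"
  assumes inv: "invertible (G x)"
  shows "riem_grad G f x = matrix_inv (G x) *v formal_grad f x"
proof -
  have "(\<forall>v. v \<bullet> (G x *v w) = formal_grad f x \<bullet> v) \<longleftrightarrow> G x *v w = formal_grad f x" for w
    by (metis inner_commute vector_eq_ldot)
  then have "(\<forall>v. v \<bullet> (G x *v w) = formal_grad f x \<bullet> v) \<longleftrightarrow>
      w = matrix_inv (G x) *v formal_grad f x" for w
    by (metis matrix_inv_cancel[OF inv])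
  then show ?thesis
    using inv by (simp add: riem_grad_def)
qed

section \<open>Symmetry and rank of the induced metric\<close>

lemma transpose_induced_metric: "transpose (induced_metric J x) = induced_metric J x"
  by (simp add: induced_metric_def matrix_transpose_mul)

lemma invertible_induced_metric_iff:
  fixes J :: "real^'n::finite \<Rightarrow> real^'n^'n"
  shows "invertible (induced_metric J x) \<longleftrightarrow> rank (J x) = CARD('n)"
proof -
  \<comment> \<open>A nonzero determinant only excludes rank strictly below the dimension; this
    bound upgrades it to equality.\<close>
  have "rank (J x) \<le> CARD('n)"
    using rank_bound[of "J x"] by simp
  then show ?thesis
    by (auto simp: invertible_det_nz induced_metric_def det_mul det_eq_0_rank)
qed

text \<open>(A6) concerns derivatives with \<open>z\<close> held fixed, whereas the entries of
  \<open>G\<close> also depend on the point through the inverse maps. Existence of the derivatives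
  in the Christoffel symbols is therefore stated separately, as \<open>G_diff\<close>.\<close>

theorem corollary2:
  fixes M :: "'a measure" and X :: "'a \<Rightarrow> real^'n::finite" and \<rho> :: "real^'n \<Rightarrow> real"
    and K m :: nat and \<pi> :: "nat \<Rightarrow> 'n set"
    and D :: "'n \<Rightarrow> ('n \<Rightarrow> real) set" and r :: "'n \<Rightarrow> real \<Rightarrow> ('n \<Rightarrow> real) \<Rightarrow> 'n \<Rightarrow> real"
    and Z :: "'n \<Rightarrow> 'a \<Rightarrow> 'n \<Rightarrow> real"
    and f :: "real^'n \<Rightarrow> real" and x :: "real^'n"
  defines "\<Omega> \<equiv> density_support \<rho>"
    and "J \<equiv> dep_jacobian K \<pi> D r"
  defines "G \<equiv> induced_metric J"
  defines "Ginv \<equiv> metric_inverse m (G x)"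
  assumes "prob_space M"
    and blocks: "independent_blocks M X K \<pi>"
    and models: "\<And>k i. k \<in> {2..K} \<Longrightarrow> i \<in> \<pi> k \<Longrightarrow>
          dependency_model M X \<Omega> (\<pi> k) i (D i) (r i) (Z i)"
    and A2_joint: "continuous_with_density M X \<rho>"
    and A2_marginal: "\<And>i. \<exists>\<rho>i. continuous_with_density M (\<lambda>\<omega>. X \<omega> $ i) \<rho>i"
    and A5: "\<And>y. formally_differentiable f y"
            "\<And>j y. formally_differentiable (partial_deriv j f) y"
    and A6: "\<And>k i. k \<in> {2..K} \<Longrightarrow> i \<in> \<pi> k \<Longrightarrow>
          twice_diff_explanatory \<Omega> (\<pi> k) i (D i) (r i)"
    and G_diff: "\<And>i l y. y \<in> \<Omega> \<Longrightarrow> formally_differentiable (\<lambda>y. G y $ i $ l) y"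
    and sample: "x \<in> \<Omega>"
    and rank_J: "rank (J x) = m"
  shows "riem_grad G f x = Ginv *v formal_grad f x \<and>
    (\<forall>i j. riem_hess \<Omega> G f x $ i $ j =
       second_partial i j f x - (\<Sum>k\<in>UNIV. christoffel Ginv G k i j x * partial_deriv k f x))"
proof -
  have sym: "\<And>y. transpose (G y) = G y"
    by (simp add: G_def transpose_induced_metric)
  \<comment> \<open>This aligns the case split of \<open>metric_inverse\<close>, made on
    \<open>m\<close>, with that of \<open>riem_grad\<close> and \<open>riem_hess\<close>, made on
    invertibility.\<close>
  have inv_iff: "invertible (G x) \<longleftrightarrow> m = CARD('n)"
    using rank_J by (auto simp: G_def invertible_induced_metric_iff)
  show ?thesis
  proof (cases "invertible (G x)")
    case True
    then have "Ginv = matrix_inv (G x)"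
      using inv_iff by (simp add: Ginv_def metric_inverse_def)
    then show ?thesis
      using riem_grad_nondegenerate[where G = G, OF True]
        riem_hess_nondegenerate[where G = G, OF sym G_diff True sample]
      by simp
  next
    case False
    then have "Ginv = moore_penrose (G x)"
      using inv_iff by (simp add: Ginv_def metric_inverse_def)
    then show ?thesis
      using False by (simp add: riem_grad_def riem_hess_def)
  qed
qed

end
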